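(* Suppose that the sequence $\{\mathcal{M}_z^n\mathcal{L}^n\}_{n}$ converges to $0$ in the strong operator topology on $\mathcal{B}$. Put $\Omega'=\{\frac{1}{\lambda}\colon \lambda\in\mathbb{C},\ \lambda\notin\sigma(\mathcal{M}_z)\}$. Then $\mathcal{L}$ is a Cowen-Douglas operator of class $\mathscr{B}_n(\Omega')$, where $n=\dim\ker\mathcal{L}$; that is, conditions (i)-(iv) in the definition of the Cowen-Douglas class (given in the context) hold for the operator $\mathcal{L}$ and the set $\Omega'$.
   Context: Notation: for a Banach space $\mathcal{X}$, $\boldsymbol{B}(\mathcal{X})$ is the Banach algebra of bounded linear operators on $\mathcal{X}$; $\sigma(T)$, $\ker T$ and $\mathrm{ran}\,T$ denote spectrum, kernel and range; $\bigvee$ denotes closed linear span. $\mathbb{N}$ is the set of positive integers. Setting. Let $\Omega\subset\mathbb{C}$ be a domain (nonempty connected open set), $E$ a complex Hilbert space, $n\in\mathbb{N}$, and $\mathcal{B}$ a complex Banach space of $E$-valued analytic functions on $\Omega$. Let $\mathcal{M}_z\in\boldsymbol{B}(\mathcal{B})$ be the operator of multiplication by the independent variable, $(\mathcal{M}_z f)(z)=zf(z)$, assumed to be left-invertible, and let $\mathcal{L}\in\boldsymbol{B}(\mathcal{B})$ be a left inverse of it, $\mathcal{L}\mathcal{M}_z=I$. Assume: (1) the inclusion map $\mathcal{B}\hookrightarrow \mathrm{Hol}(\Omega,E)$ is continuous, where $\mathrm{Hol}(\Omega,E)$ is the space of $E$-valued holomorphic functions on $\Omega$ with the topology of locally uniform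 convergence; (2) $\dim\ker\mathcal{L}=n$; (3) every $f\in\ker\mathcal{L}$ is analytic in (i.e. extends analytically to) an open neighborhood of $\overline{\Omega}$; (4) for every $f\in\mathcal{B}$ and every $\lambda\in\Omega$ there exist $g\in\mathcal{B}$ and $h\in\ker\mathcal{L}$ such that $f=(\mathcal{M}_z-\lambda)g+h$; (5) $\sigma(\mathcal{M}_z)=\overline{\Omega}$. Cowen-Douglas class. For a connected open set $G\subset\mathbb{C}$ and $n\in\mathbb{N}$, the class $\mathscr{B}_n(G)$ consists of the operators $T\in\boldsymbol{B}(\mathcal{B})$ such that (i) $G\subseteq\sigma(T)$; (ii) $\mathrm{ran}(T-\omega)=\mathcal{B}$ for all $\omega\in G$; (iii) $\bigvee_{\omega\in G}\ker(T-\omega)=\mathcal{B}$; (iv) $\dim\ker(T-\omega)=n$ for all $\omega\in G$. *)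

theory Defs
  imports "HOL-Analysis.Analysis"
begin

section \<open>Complex Banach and Hilbert spaces\<close>

text \<open>The library has only real normed spaces. As for \<^class>\<open>real_normed_vector\<close>, the complex
  structure is added by type classes that extend the real ones, the real scalar multiplication
  being the restriction of the complex one.\<close>

class complex_vector = real_vector +
  fixes scaleC :: "complex \<Rightarrow> 'a \<Rightarrow> 'a"  (infixr \<open>*\<^sub>C\<close> 75)
  assumes scaleC_add_right: "a *\<^sub>C (x + y) = a *\<^sub>C x + a *\<^sub>C y"
    and scaleC_add_left: "(a + b) *\<^sub>C x = a *\<^sub>C x + b *\<^sub>C x"
    and scaleC_scaleC: "a *\<^sub>C b *\<^sub>C x = (a * b) *\<^sub>C x"
    and scaleC_one: "1 *\<^sub>C x = x"
    and scaleR_scaleC: "r *\<^sub>R x = complex_of_real r *\<^sub>C x"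

class complex_normed_vector = complex_vector + real_normed_vector +
  assumes norm_scaleC: "norm (a *\<^sub>C x) = cmod a * norm x"

class cbanach = complex_normed_vector + banach

text \<open>Positive definiteness of the inner product follows from \<open>cinner_self\<close> and the norm axioms.\<close>

class complex_inner = complex_normed_vector +
  fixes cinner :: "'a \<Rightarrow> 'a \<Rightarrow> complex"
  assumes cinner_commute: "cinner x y = cnj (cinner y x)"
    and cinner_add_left: "cinner (x + y) z = cinner x z + cinner y z"
    and cinner_scaleC_left: "cinner (a *\<^sub>C x) y = a * cinner x y"
    and cinner_self: "cinner x x = complex_of_real ((norm x)\<^sup>2)"

class chilbert_space = complex_inner + cbanach

instantiation complex :: chilbert_space
begin

definition scaleC_complex :: "complex \<Rightarrow> complex \<Rightarrow> complex"
  where "scaleC_complex a x = a * x"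

definition cinner_complex :: "complex \<Rightarrow> complex \<Rightarrow> complex"
  where "cinner_complex x y = x * cnj y"

instance
  by standard
    (auto simp: scaleC_complex_def cinner_complex_def algebra_simps norm_mult scaleR_conv_of_real
      complex_norm_square[symmetric] simp flip: of_real_power)

end

global_interpretation complex_vector: vector_space "scaleC :: complex \<Rightarrow> 'a \<Rightarrow> 'a::complex_vector"
  by standard (simp_all add: scaleC_add_right scaleC_add_left scaleC_scaleC scaleC_one)


section \<open>Bounded operators and Banach spaces of analytic functions\<close>

locale bounded_clinear = bounded_linear T
  for T :: "'a::complex_normed_vector \<Rightarrow> 'b::complex_normed_vector" +
  assumes scaleC: "T (c *\<^sub>C x) = c *\<^sub>C T x"

definition ker :: "('a \<Rightarrow> 'b::zero) \<Rightarrow> 'a set"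
  where "ker T = {x. T x = 0}"

definition shift :: "('a \<Rightarrow> 'a) \<Rightarrow> complex \<Rightarrow> 'a \<Rightarrow> 'a::complex_vector"
  where "shift T c = (\<lambda>x. T x - c *\<^sub>C x)"

definition spectrum :: "('a \<Rightarrow> 'a::complex_normed_vector) \<Rightarrow> complex set"
  where "spectrum T =
    {c. \<not> (\<exists>S. bounded_clinear S \<and> S \<circ> shift T c = id \<and> shift T c \<circ> S = id)}"

definition vholomorphic_on :: "(complex \<Rightarrow> 'a::complex_normed_vector) \<Rightarrow> complex set \<Rightarrow> bool"
    (infixl \<open>vholomorphic'_on\<close> 50)
  where "f vholomorphic_on S \<longleftrightarrow>
    (\<forall>z\<in>S. \<exists>d. (f has_derivative (\<lambda>h. h *\<^sub>C d)) (at z within S))"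

text \<open>A Banach space of \<open>E\<close>-valued analytic functions on \<open>\<Omega>\<close> is a type \<open>'b\<close> of class
  \<^class>\<open>cbanach\<close> together with the map \<open>ev\<close> which sends an element to the function it is.
  By \<open>ev_inject\<close> elements are determined by their values on \<open>\<Omega>\<close>, and the vector space operations
  are pointwise; the norm is arbitrary. The values of \<open>ev f\<close> outside \<open>\<Omega>\<close> carry no meaning.\<close>

locale analytic_function_space =
  fixes \<Omega> :: "complex set" and ev :: "'b::cbanach \<Rightarrow> complex \<Rightarrow> 'e::chilbert_space"
  assumes ev_holomorphic: "ev f vholomorphic_on \<Omega>"
    and ev_inject: "(\<And>z. z \<in> \<Omega> \<Longrightarrow> ev f z = ev g z) \<Longrightarrow> f = g"
    and ev_add: "z \<in> \<Omega> \<Longrightarrow> ev (f + g) z = ev f z + ev g z"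
    and ev_scaleC: "z \<in> \<Omega> \<Longrightarrow> ev (c *\<^sub>C f) z = c *\<^sub>C ev f z"

text \<open>Continuity of the inclusion into the \<open>E\<close>-valued holomorphic functions on the open set \<open>\<Omega>\<close>,
  whose topology of locally uniform convergence is that of uniform convergence on the compact
  subsets of \<open>\<Omega>\<close>: if \<open>g\<close> tends to \<open>f\<close> in the norm, then \<open>ev g\<close> tends to \<open>ev f\<close> in this topology.\<close>

definition continuous_inclusion ::
    "complex set \<Rightarrow> ('b::cbanach \<Rightarrow> complex \<Rightarrow> 'e::chilbert_space) \<Rightarrow> bool"
  where "continuous_inclusion \<Omega> ev \<longleftrightarrow>
    (\<forall>f K. compact K \<longrightarrow> K \<subseteq> \<Omega> \<longrightarrow> uniform_limit K ev (ev f) (nhds f))"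


section \<open>The Cowen-Douglas class\<close>

text \<open>The dimension \<open>complex_vector.dim\<close> is \<open>0\<close> for infinite-dimensional spaces, so the last
  condition has its usual meaning only for \<open>n \<ge> 1\<close>. The class is usually introduced for
  connected open \<open>G\<close>; the conditions make sense for every set \<open>G\<close>, and no restriction on \<open>G\<close> is
  built in.\<close>

definition cowen_douglas :: "nat \<Rightarrow> complex set \<Rightarrow> ('a \<Rightarrow> 'a::cbanach) \<Rightarrow> bool"
  where "cowen_douglas n G T \<longleftrightarrow>
    bounded_clinear T \<and>
    G \<subseteq> spectrum T \<and>
    (\<forall>\<omega>\<in>G. range (shift T \<omega>) = UNIV) \<and>
    closure (complex_vector.span (\<Union>\<omega>\<in>G. ker (shift T \<omega>))) = UNIV \<and>
    (\<forall>\<omega>\<in>G. complex_vector.dim (ker (shift T \<omega>)) = n)"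

end

theory Submission
  imports Defs
begin

text \<open>For \<open>c \<notin> \<sigma>(M)\<close> the identity \<open>L - 1/c = -(1/c) L (M - c)\<close> with \<open>M - c\<close> invertible gives
  surjectivity of \<open>L - 1/c\<close> and \<open>ker (L - 1/c) = (M - c)\<inverse> ker L\<close>. For small \<open>w \<noteq> 0\<close> the kernel of
  \<open>L - w\<close> is therefore \<open>(1 - w M)\<inverse> ker L\<close>. The coefficients \<open>M ^ j h\<close> of the expansion of
  \<open>(1 - w M)\<inverse> h\<close> in powers of \<open>w\<close> lie in the closed linear span of its values, and the closed linear
  span of the sets \<open>M ^ j (ker L)\<close> is everything, because
  \<open>f - M ^ k (L ^ k f) = (\<Sum>j<k. M ^ j (1 - M L) (L ^ j f))\<close> tends to \<open>f\<close>.\<close>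

section \<open>Complex linear preliminaries: closed subspaces, dimension, invertibility\<close>

lemma bounded_linear_scaleC: "bounded_linear (\<lambda>x::'a::complex_normed_vector. c *\<^sub>C x)"
  by (rule bounded_linear_intro[where K = "cmod c"])
    (simp_all add: scaleC_add_right scaleR_scaleC scaleC_scaleC norm_scaleC mult.commute)

lemma subspace_closure:
  fixes S :: "'a::complex_normed_vector set"
  assumes "complex_vector.subspace S"
  shows "complex_vector.subspace (closure S)"
  unfolding complex_vector.subspace_def
proof (intro conjI ballI allI)
  show "0 \<in> closure S"
    using complex_vector.subspace_0[OF assms] closure_subset by blast
next
  fix x y assume "x \<in> closure S" "y \<in> closure S"
  then obtain f g where "\<And>n. f n \<in> S" "f \<longlonglongrightarrow> x" "\<And>n. g n \<in> S" "g \<longlonglongrightarrow> y"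
    unfolding closure_sequential by blast
  then show "x + y \<in> closure S"
    unfolding closure_sequential
    by (intro exI[of _ "\<lambda>n. f n + g n"])
      (auto intro!: tendsto_add complex_vector.subspace_add[OF assms])
next
  fix c x assume "x \<in> closure S"
  then obtain f where "\<And>n. f n \<in> S" "f \<longlonglongrightarrow> x"
    unfolding closure_sequential by blast
  then show "c *\<^sub>C x \<in> closure S"
    unfolding closure_sequential
    by (intro exI[of _ "\<lambda>n. c *\<^sub>C f n"])
      (auto intro!: bounded_linear.tendsto[OF bounded_linear_scaleC]
        complex_vector.subspace_scale[OF assms])
qed

lemma bounded_clinear_linear:
  assumes "bounded_clinear T"
  shows "Vector_Spaces.linear scaleC scaleC T"
proof -
  interpret bounded_clinear T by fact
  show ?thesis
    by unfold_locales (auto simp: add scaleC)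
qed

text \<open>A basis of \<open>S\<close> is carried to a basis of the image with the same
  \<open>card\<close>. Infinite bases cause no trouble, since injectivity preserves
  \<open>card\<close> for them too (both are 0).\<close>

lemma dim_image_inj:
  assumes "Vector_Spaces.linear scaleC scaleC f" "inj f"
  shows "complex_vector.dim (f ` S) = complex_vector.dim S"
proof -
  interpret Vector_Spaces.linear scaleC scaleC f by fact
  obtain B where B: "B \<subseteq> S" "complex_vector.independent B" "S \<subseteq> complex_vector.span B"
    "card B = complex_vector.dim S"
    using complex_vector.basis_exists by blast
  show ?thesis
  proof (rule complex_vector.dim_unique)
    show "f ` B \<subseteq> f ` S" "f ` S \<subseteq> complex_vector.span (f ` B)"
      using B by (auto simp: span_image)
    show "complex_vector.independent (f ` B)"
      using B(2) assms(2) independent_inj_image by blast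
    show "card (f ` B) = complex_vector.dim S"
      using B(4) assms(2) card_image inj_on_subset by (metis top_greatest)
  qed
qed

lemma dim_subset_zero: "S \<subseteq> {0} \<Longrightarrow> complex_vector.dim S = 0"
  by (rule complex_vector.dim_unique[of "{}"]) (auto simp: complex_vector.independent_empty)

text \<open>The lower bound does double duty: it forces injectivity and bounds the inverse by
  \<open>B\<close>, so the open mapping theorem can be avoided.\<close>

lemma notin_spectrumI:
  assumes T: "bounded_clinear T" and surj: "\<And>y. \<exists>x. shift T c x = y"
    and below: "\<And>x. norm x \<le> norm (shift T c x) * B"
  shows "c \<notin> spectrum T"
proof -
  interpret bounded_clinear T by fact
  let ?A = "shift T c"
  have add: "?A (x + y) = ?A x + ?A y" for x y
    by (simp add: shift_def add scaleC_add_right)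
  have scale: "?A (a *\<^sub>C x) = a *\<^sub>C ?A x" for a x
    by (simp add: shift_def scaleC scaleC_scaleC mult.commute complex_vector.scale_right_diff_distrib)
  have inj: "inj ?A"
  proof (rule injI)
    fix x y assume "?A x = ?A y"
    moreover have "?A x = ?A (x - y) + ?A y"
      by (simp flip: add)
    ultimately show "x = y"
      using below[of "x - y"] by simp
  qed
  have bij: "bij ?A"
    using inj surj by (metis bij_def surjI)
  let ?S = "inv ?A"
  have AS: "?A (?S y) = y" for y
    using bij by (simp add: bij_is_surj surj_f_inv_f)
  have SA: "?S (?A x) = x" for x
    using inj by simp
  have scaleS: "?S (a *\<^sub>C y) = a *\<^sub>C ?S y" for a y
    by (metis AS SA scale)
  have "bounded_linear ?S"
  proof (rule bounded_linear_intro)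
    show "?S (x + y) = ?S x + ?S y" for x y
      by (metis AS SA add)
    show "?S (r *\<^sub>R x) = r *\<^sub>R ?S x" for r x
      by (simp add: scaleR_scaleC scaleS)
    show "norm (?S x) \<le> norm x * B" for x
      using below[of "?S x"] by (simp add: AS)
  qed
  then have "bounded_clinear ?S"
    by (intro bounded_clinear.intro bounded_clinear_axioms.intro scaleS)
  moreover have "?S \<circ> ?A = id" "?A \<circ> ?S = id"
    using AS SA by auto
  ultimately show ?thesis
    unfolding spectrum_def by blast
qed

section \<open>The resolvent near infinity and its power series coefficients\<close>

lemma resolvent_bound:
  fixes M :: "'a::complex_normed_vector \<Rightarrow> 'a"
  assumes K: "\<And>x. norm (M x) \<le> norm x * K" and w: "cmod w * K \<le> 1/2"
  shows "norm x \<le> 2 * norm (x - w *\<^sub>C M x)"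
proof -
  have "norm (w *\<^sub>C M x) \<le> cmod w * (norm x * K)"
    unfolding norm_scaleC by (intro mult_left_mono K) simp
  also have "\<dots> = (cmod w * K) * norm x"
    by simp
  also have "\<dots> \<le> 1/2 * norm x"
    by (intro mult_right_mono w) simp
  finally show ?thesis
    using norm_triangle_ineq2[of x "w *\<^sub>C M x"] by simp
qed

text \<open>A solution is a fixed point of \<open>x\<close> \<mapsto>
  \<open>h + w *\<^sub>C M x\<close>, a contraction with constant 1/2; Banach's theorem takes the
  place of the Neumann series.\<close>

lemma resolvent_exists:
  fixes M :: "'a::cbanach \<Rightarrow> 'a"
  assumes M: "bounded_clinear M" and K: "\<And>x. norm (M x) \<le> norm x * K"
    and w: "cmod w * K \<le> 1/2"
  shows "\<exists>x. x - w *\<^sub>C M x = h"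
proof -
  interpret bounded_clinear M by fact
  have "dist (h + w *\<^sub>C M x) (h + w *\<^sub>C M y) \<le> 1/2 * dist x y" for x y
  proof -
    have "dist (h + w *\<^sub>C M x) (h + w *\<^sub>C M y) = cmod w * norm (M (x - y))"
      by (simp add: dist_norm diff norm_scaleC flip: complex_vector.scale_right_diff_distrib)
    also have "\<dots> \<le> cmod w * (norm (x - y) * K)"
      by (intro mult_left_mono K) simp
    also have "\<dots> = (cmod w * K) * norm (x - y)"
      by simp
    also have "\<dots> \<le> 1/2 * norm (x - y)"
      by (intro mult_right_mono w) simp
    finally show ?thesis
      by (simp add: dist_norm)
  qed
  then have "\<exists>!x. h + w *\<^sub>C M x = x"
    by (intro banach_fix_type[of "1/2"]) auto
  then show ?thesis
    by (metis add_diff_cancel_right')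
qed

text \<open>Up to the nonzero factor \<open>- w\<close>, the operators \<open>1 - w M\<close> and
  \<open>M - 1/w\<close> agree, so solvability and the lower bound carry over.\<close>

lemma inverse_notin_spectrum:
  fixes M :: "'a::cbanach \<Rightarrow> 'a"
  assumes M: "bounded_clinear M" and K: "\<And>x. norm (M x) \<le> norm x * K"
    and w: "cmod w * K \<le> 1/2" "w \<noteq> 0"
  shows "1 / w \<notin> spectrum M"
proof (rule notin_spectrumI[OF M])
  have shift: "x - w *\<^sub>C M x = (- w) *\<^sub>C shift M (1 / w) x" for x
    using w(2) by (simp add: shift_def complex_vector.scale_right_diff_distrib scaleC_scaleC scaleC_one)
  show "\<exists>x. shift M (1 / w) x = y" for y
  proof -
    obtain x where "x - w *\<^sub>C M x = (- w) *\<^sub>C y"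
      using resolvent_exists[OF M K w(1)] by blast
    then show ?thesis
      using w(2) unfolding shift by (metis complex_vector.scale_cancel_left neg_equal_0_iff_equal)
  qed
  show "norm x \<le> norm (shift M (1 / w) x) * (2 * cmod w)" for x
    using resolvent_bound[of M, OF K w(1), of x] unfolding shift norm_scaleC by (simp add: mult_ac)
qed

text \<open>Extracts the power series coefficients of \<open>(1 - w M)\<inverse> h\<close> inside \<open>V\<close>, one at a time:
  the second conclusion comes from the difference quotient
  \<open>((1 - w M)\<inverse> h - h) / w = (1 - w M)\<inverse> (M h)\<close>.\<close>

lemma resolvent_coefficient:
  fixes M :: "'a::cbanach \<Rightarrow> 'a"
  assumes M: "bounded_clinear M" and K: "K > 0" "\<And>x. norm (M x) \<le> norm x * K"
    and V: "closed V" "complex_vector.subspace V"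
    and h: "\<And>w x. w \<noteq> 0 \<Longrightarrow> cmod w * K \<le> 1/2 \<Longrightarrow> x - w *\<^sub>C M x = h \<Longrightarrow> x \<in> V"
  shows "h \<in> V"
    and "w \<noteq> 0 \<Longrightarrow> cmod w * K \<le> 1/2 \<Longrightarrow> x - w *\<^sub>C M x = M h \<Longrightarrow> x \<in> V"
proof -
  interpret bounded_clinear M by fact
  \<comment> \<open>A sequence of nonzero scalars tending to 0, scaled so that
    \<open>cmod (W k) * K\<close> is 1/2 divided by \<open>Suc k\<close> and hence
    admissible.\<close>
  define W where "W k = complex_of_real (1 / (2 * K) * inverse (real (Suc k)))" for k
  have W_pos: "1 / (2 * K) * inverse (real (Suc k)) > 0" for k
    using K(1) by (intro mult_pos_pos) auto
  have W0: "W k \<noteq> 0" for k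
    using W_pos[of k] unfolding W_def of_real_eq_0_iff by linarith
  have "cmod (W k) * K = 1/2 * inverse (real (Suc k))" for k
    using K(1) abs_of_pos[OF W_pos[of k]] unfolding W_def norm_of_real by simp
  moreover have "inverse (real (Suc k)) \<le> 1" for k
    by (simp add: field_simps)
  ultimately have W1: "cmod (W k) * K \<le> 1/2" for k
    by simp
  have "\<forall>k. \<exists>x. x - W k *\<^sub>C M x = h"
    using resolvent_exists[OF M K(2) W1] by blast
  then obtain X where X: "\<And>k. X k - W k *\<^sub>C M (X k) = h"
    by metis
  \<comment> \<open>As \<open>norm (X k)\<close> is at most \<open>2 * norm h\<close>, this
    difference is of order \<open>W k\<close>; so \<open>X\<close> tends to \<open>h\<close> inside
    the closed set \<open>V\<close>.\<close>
  have "X k - h = W k *\<^sub>C M (X k)" for k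
    using X[of k] by (metis diff_diff_eq2 add_diff_cancel_left')
  then have "norm (X k - h) \<le> cmod (W k) * (norm (X k) * K)" for k
    by (simp add: norm_scaleC K(2) mult_left_mono)
  moreover have "cmod (W k) * (norm (X k) * K) \<le> cmod (W k) * ((2 * norm h) * K)" for k
    using resolvent_bound[of M, OF K(2) W1[of k], of "X k"] K(1) unfolding X
    by (intro mult_left_mono mult_right_mono) auto
  ultimately have bound: "norm (X k - h) \<le> cmod (W k) * ((2 * norm h) * K)" for k
    using order_trans by blast
  have "(\<lambda>k. 1 / (2 * K) * inverse (real (Suc k))) \<longlonglongrightarrow> 1 / (2 * K) * 0"
    by (intro tendsto_mult tendsto_const LIMSEQ_inverse_real_of_nat)
  then have "W \<longlonglongrightarrow> 0"
    unfolding W_def by (metis mult_zero_right of_real_0 tendsto_of_real)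
  then have "(\<lambda>k. cmod (W k) * ((2 * norm h) * K)) \<longlonglongrightarrow> 0"
    by (intro tendsto_mult_left_zero tendsto_norm_zero)
  then have "(\<lambda>k. X k - h) \<longlonglongrightarrow> 0"
    by (rule Lim_null_comparison[rotated]) (simp add: bound)
  then have "X \<longlonglongrightarrow> h"
    by (rule LIM_zero_cancel)
  moreover have "X k \<in> V" for k
    using h W0 W1 X by blast
  ultimately show hV: "h \<in> V"
    using V(1) closed_sequentially by blast
  assume w: "w \<noteq> 0" "cmod w * K \<le> 1/2" and x: "x - w *\<^sub>C M x = M h"
  have "h + w *\<^sub>C x - w *\<^sub>C M (h + w *\<^sub>C x) = h + w *\<^sub>C (x - w *\<^sub>C M x) - w *\<^sub>C M h"
    by (simp add: add scaleC complex_vector.scale_right_diff_distrib scaleC_add_right)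
  also have "\<dots> = h"
    by (simp add: x)
  finally have "h + w *\<^sub>C x \<in> V"
    using h w by blast
  then have "h + w *\<^sub>C x - h \<in> V"
    using complex_vector.subspace_diff[OF V(2)] hV by blast
  then have "(1 / w) *\<^sub>C (h + w *\<^sub>C x - h) \<in> V"
    by (rule complex_vector.subspace_scale[OF V(2)])
  then show "x \<in> V"
    using w(1) by (simp add: scaleC_scaleC scaleC_one)
qed

lemma power_in_closed_span_resolvents:
  fixes M :: "'a::cbanach \<Rightarrow> 'a"
  assumes M: "bounded_clinear M" and K: "K > 0" "\<And>x. norm (M x) \<le> norm x * K"
    and V: "closed V" "complex_vector.subspace V"
    and h: "\<And>w x. w \<noteq> 0 \<Longrightarrow> cmod w * K \<le> 1/2 \<Longrightarrow> x - w *\<^sub>C M x = h \<Longrightarrow> x \<in> V"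
  shows "(M ^^ j) h \<in> V"
proof -
  \<comment> \<open>The induction carries membership of \<open>(1 - w M)\<inverse> (M ^ j h)\<close>
    for all small nonzero \<open>w\<close>: knowing only that \<open>M ^ j h\<close> lies in
    \<open>V\<close> would not reach the next power.\<close>
  have "\<forall>w x. w \<noteq> 0 \<longrightarrow> cmod w * K \<le> 1/2 \<longrightarrow> x - w *\<^sub>C M x = (M ^^ j) h \<longrightarrow> x \<in> V"
  proof (induction j)
    case (Suc j)
    then show ?case
      using resolvent_coefficient(2)[OF M K V, of "(M ^^ j) h"] by simp
  qed (use h in simp)
  then show ?thesis
    using resolvent_coefficient(1)[OF M K V] by blast
qed

text \<open>The difference telescopes. Each increment is a power of \<open>M\<close> applied to a
  vector \<open>g - M (L g)\<close>, which lies in \<open>ker L\<close> because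
  \<open>L M = 1\<close>.\<close>

lemma left_inverse_remainder_in_subspace:
  fixes M L :: "'a::cbanach \<Rightarrow> 'a"
  assumes M: "bounded_clinear M" and L: "bounded_clinear L" and LM: "L \<circ> M = id"
    and V: "complex_vector.subspace V" and ker: "\<And>h j. h \<in> ker L \<Longrightarrow> (M ^^ j) h \<in> V"
  shows "f - (M ^^ k) ((L ^^ k) f) \<in> V"
proof (induction k)
  case 0
  then show ?case
    using complex_vector.subspace_0[OF V] by simp
next
  case (Suc k)
  interpret M: bounded_clinear M by fact
  interpret L: bounded_clinear L by fact
  have LM': "L (M x) = x" for x
    using LM by (simp add: fun_eq_iff)
  have diff: "(M ^^ j) (x - y) = (M ^^ j) x - (M ^^ j) y" for j x y
    by (induction j) (simp_all add: M.diff)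
  let ?g = "(L ^^ k) f"
  have "(M ^^ k) (?g - M (L ?g)) \<in> V"
    by (rule ker) (simp add: ker_def L.diff LM')
  then have "(M ^^ k) ?g - (M ^^ Suc k) ((L ^^ Suc k) f) \<in> V"
    by (simp add: diff funpow_swap1)
  with Suc have "(f - (M ^^ k) ?g) + ((M ^^ k) ?g - (M ^^ Suc k) ((L ^^ Suc k) f)) \<in> V"
    using complex_vector.subspace_add[OF V] by blast
  then show ?case
    by simp
qed

theorem theorem2p1:
  fixes \<Omega> :: "complex set"
    and ev :: "'b::cbanach \<Rightarrow> complex \<Rightarrow> 'e::chilbert_space"
    and M L :: "'b \<Rightarrow> 'b"
    and n :: nat
  assumes domain: "open \<Omega>" "connected \<Omega>" "\<Omega> \<noteq> {}"
    and n_pos: "n \<ge> 1"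
    and space: "analytic_function_space \<Omega> ev"
    and M_bounded: "bounded_clinear M"
    and M_mult: "\<And>f z. z \<in> \<Omega> \<Longrightarrow> ev (M f) z = z *\<^sub>C ev f z"
    and L_bounded: "bounded_clinear L"
    and L_left_inverse: "L \<circ> M = id"
    and inclusion: "continuous_inclusion \<Omega> ev"
    and dim_ker: "complex_vector.dim (ker L) = n"
    and ker_extends: "\<And>f. f \<in> ker L \<Longrightarrow>
        \<exists>U F. open U \<and> closure \<Omega> \<subseteq> U \<and> F vholomorphic_on U \<and> (\<forall>z\<in>\<Omega>. F z = ev f z)"
    and decomposition: "\<And>f c. c \<in> \<Omega> \<Longrightarrow> \<exists>g. \<exists>h\<in>ker L. f = shift M c g + h"
    and spectrum_M: "spectrum M = closure \<Omega>"
    and SOT_limit: "\<And>f. (\<lambda>k. (M ^^ k) ((L ^^ k) f)) \<longlonglongrightarrow> 0"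
  shows "cowen_douglas n {1 / c |c. c \<notin> spectrum M} L"
proof -
  interpret M: bounded_clinear M by fact
  interpret L: bounded_clinear L by fact
  have LM: "L (M x) = x" for x
    using L_left_inverse by (simp add: fun_eq_iff)
  have "ker L \<noteq> {0}"
    using n_pos dim_ker dim_subset_zero[of "ker L"] by auto
  moreover have "0 \<in> ker L"
    by (simp add: ker_def L.zero)
  ultimately obtain h0 where h0: "h0 \<in> ker L" "h0 \<noteq> 0"
    by blast
  \<comment> \<open>Since \<open>1 / 0 = 0\<close>, it must be excluded that \<open>c = 0\<close> contributes a point to \<open>\<Omega>'\<close>.\<close>
  have zero: "0 \<in> spectrum M"
  proof (rule ccontr)
    assume "0 \<notin> spectrum M"
    then obtain S where "shift M 0 \<circ> S = id"
      unfolding spectrum_def by blast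
    then have "M (S h0) = h0"
      by (simp add: shift_def fun_eq_iff)
    \<comment> \<open>Applying \<open>L\<close> to \<open>M (S h0) = h0\<close> gives
      \<open>S h0 = 0\<close>, whence \<open>h0 = M 0 = 0\<close>.\<close>
    then show False
      using h0 LM[of "S h0"] by (simp add: ker_def M.zero)
  qed

  \<comment> \<open>Surjectivity, kernels and spectrum of \<open>L\<close> on
    \<open>\<Omega>'\<close>\<close>
  have point: "(\<exists>x. shift L (1 / c) x = y) \<and> complex_vector.dim (ker (shift L (1 / c))) = n"
    if c: "c \<notin> spectrum M" for c y
  proof -
    have c0: "c \<noteq> 0"
      using zero c by blast
    obtain S where S: "bounded_clinear S" "S \<circ> shift M c = id" "shift M c \<circ> S = id"
      using c unfolding spectrum_def by blast
    have SA: "S (shift M c x) = x" and AS: "shift M c (S x) = x" for x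
      using S by (simp_all add: fun_eq_iff)
    have L_shift: "L (shift M c x) = (- c) *\<^sub>C shift L (1 / c) x" for x
      using c0 by (simp add: shift_def L.diff L.scaleC LM complex_vector.scale_right_diff_distrib
          scaleC_scaleC scaleC_one)
    \<comment> \<open>The witness solves \<open>(M - c) x = M (- c y)\<close>; applying
      \<open>L\<close> turns this into \<open>- c (L - 1/c) x = - c y\<close>.\<close>
    have "shift L (1 / c) (S (M ((- c) *\<^sub>C y))) = y"
    proof -
      have "(- c) *\<^sub>C shift L (1 / c) (S (M ((- c) *\<^sub>C y))) = (- c) *\<^sub>C y"
        by (simp only: L_shift[symmetric] AS LM)
      then show ?thesis
        using c0 by (metis complex_vector.scale_cancel_left neg_equal_0_iff_equal)
    qed
    moreover have "ker (shift L (1 / c)) = S ` ker L"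
    proof -
      have iff: "x \<in> ker (shift L (1 / c)) \<longleftrightarrow> shift M c x \<in> ker L" for x
        using c0 by (simp add: ker_def L_shift)
      show ?thesis
      proof (intro equalityI subsetI)
        fix x assume "x \<in> ker (shift L (1 / c))"
        then show "x \<in> S ` ker L"
          by (intro image_eqI[of _ _ "shift M c x"]) (simp_all add: SA iff)
      qed (auto simp: iff AS)
    qed
    moreover have "inj S"
      using AS by (metis injI)
    ultimately show ?thesis
      using dim_image_inj[OF bounded_clinear_linear[OF S(1)], of "ker L"] dim_ker by auto
  qed
  \<comment> \<open>As \<open>n\<close> is at least 1, \<open>1 / c\<close> is an eigenvalue of
    \<open>L\<close>: a left inverse of \<open>L - 1/c\<close> would make the kernel trivial, of
    dimension 0.\<close>
  have spec: "1 / c \<in> spectrum L" if "c \<notin> spectrum M" for c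
  proof (rule ccontr)
    assume "1 / c \<notin> spectrum L"
    then obtain S where S: "bounded_clinear S" "S \<circ> shift L (1 / c) = id"
      unfolding spectrum_def by blast
    interpret S: bounded_clinear S by fact
    have "S (shift L (1 / c) x) = x" for x
      using S(2) by (simp add: fun_eq_iff)
    then have "ker (shift L (1 / c)) \<subseteq> {0}"
      by (auto simp: ker_def) (metis S.zero)
    then have "complex_vector.dim (ker (shift L (1 / c))) = 0"
      by (rule dim_subset_zero)
    then show False
      using point that n_pos by simp
  qed

  \<comment> \<open>Density of the span of the eigenvectors of \<open>L\<close>\<close>
  define V where
    "V = closure (complex_vector.span (\<Union>\<omega>\<in>{1 / c |c. c \<notin> spectrum M}. ker (shift L \<omega>)))"
  have V: "closed V" "complex_vector.subspace V"
    unfolding V_def by (simp_all add: subspace_closure)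
  obtain K where K: "K > 0" "\<And>x. norm (M x) \<le> norm x * K"
    using M.pos_bounded by blast
  have "x \<in> V" if h: "h \<in> ker L" and w: "w \<noteq> 0" "cmod w * K \<le> 1/2"
    and x: "x - w *\<^sub>C M x = h" for h w x
  proof -
    \<comment> \<open>Since \<open>L M = 1\<close>, the resolvent vector \<open>x\<close> is an
      eigenvector of \<open>L\<close> for \<open>w\<close>, and \<open>w\<close> is the reciprocal
      of the regular point \<open>1 / w\<close>.\<close>
    have "L (x - w *\<^sub>C M x) = shift L w x"
      by (simp add: L.diff L.scaleC LM shift_def)
    then have "x \<in> ker (shift L w)"
      using h x by (simp add: ker_def)
    moreover have "1 / w \<notin> spectrum M"
      using inverse_notin_spectrum[OF M_bounded K(2) w(2,1)] .
    then have "w \<in> {1 / c |c. c \<notin> spectrum M}"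
      by (auto intro!: exI[of _ "1 / w"])
    ultimately show ?thesis
      unfolding V_def
      by (intro subsetD[OF closure_subset] complex_vector.span_base) blast
  qed
  then have "(M ^^ j) h \<in> V" if "h \<in> ker L" for h j
    using power_in_closed_span_resolvents[OF M_bounded K V] that by blast
  then have rem: "f - (M ^^ k) ((L ^^ k) f) \<in> V" for f k
    by (rule left_inverse_remainder_in_subspace[OF M_bounded L_bounded L_left_inverse V(2)])
  have "f \<in> V" for f
  proof -
    \<comment> \<open>Only here does the strong convergence enter: it makes \<open>f\<close> a limit
      of elements of the closed set \<open>V\<close>.\<close>
    have "(\<lambda>k. f - (M ^^ k) ((L ^^ k) f)) \<longlonglongrightarrow> f - 0"
      by (intro tendsto_diff tendsto_const SOT_limit)
    then show ?thesis
      using closed_sequentially[OF V(1), of "\<lambda>k. f - (M ^^ k) ((L ^^ k) f)"] rem by simp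
  qed
  then have "V = UNIV"
    by blast
  moreover have "range (shift L \<omega>) = UNIV" "complex_vector.dim (ker (shift L \<omega>)) = n"
    if \<omega>: "\<omega> \<in> {1 / c |c. c \<notin> spectrum M}" for \<omega>
  proof -
    obtain c where c: "\<omega> = 1 / c" "c \<notin> spectrum M"
      using \<omega> by blast
    have "y \<in> range (shift L \<omega>)" for y
      using point[OF c(2), of y] c(1) by (auto simp: image_iff)
    then show "range (shift L \<omega>) = UNIV"
      by blast
    show "complex_vector.dim (ker (shift L \<omega>)) = n"
      using point[OF c(2)] c(1) by simp
  qed
  moreover have "{1 / c |c. c \<notin> spectrum M} \<subseteq> spectrum L"
    using spec by blast
  ultimately show ?thesis
    unfolding cowen_douglas_def V_def[symmetric] by (intro conjI ballI L_bounded)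
qed

end
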